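(* Let $1<p\le 2$, $q=p/(p-1)$, $\alpha\ge 0$ and $\nu\in\mathbb{R}$ with $\alpha+\nu<1$. Then the operator $f\mapsto F_\alpha$, $$F_\alpha(\tau) = \int_0^\infty \left| K_{(i\tau+ \alpha)/2}(x)\right|^2 f(x)\,dx,\qquad \tau\in\mathbb{R},$$ is compact from $L_{\nu,p}(\mathbb{R}_+)$ into $L_q(\mathbb{R})$.
   Context: $K_\mu(z)$ is the Macdonald function (modified Bessel function of the second kind). $\mathbb{R}_+=(0,\infty)$. For $\nu\in\mathbb{R}$ and $1\le p<\infty$, $L_{\nu,p}(\mathbb{R}_+)$ is the space of functions with finite norm $\|f\|_{\nu,p}=\left(\int_0^\infty x^{\nu p-1}|f(x)|^p dx\right)^{1/p}$. *)

theory Defs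
  imports "HOL-Analysis.Analysis"
begin

text \<open>
  The Macdonald function (modified Bessel function of the second kind) of complex order, by its
  classical integral representation, which converges absolutely for every \<open>\<mu>\<close> exactly on the
  half-plane \<open>Re z > 0\<close>; the definition is meaningful there only.
\<close>

definition macdonald_K :: "complex \<Rightarrow> complex \<Rightarrow> complex" where
  "macdonald_K \<mu> z =
     (LINT u:{0..}|lebesgue. exp (- z * of_real (cosh u)) * cosh (\<mu> * of_real u))"

text \<open>
  Lebesgue spaces are represented by carrier sets of functions with a seminorm; functions are not
  identified up to null sets, and values outside \<open>{0<..}\<close> are irrelevant for \<open>L_nu\<close>.
\<close>

definition L_nu :: "real \<Rightarrow> real \<Rightarrow> (real \<Rightarrow> complex) set" where
  "L_nu \<nu> p = {f. f \<in> borel_measurable (lebesgue_on {0<..}) \<and>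
     integrable (lebesgue_on {0<..}) (\<lambda>x. x powr (\<nu> * p - 1) * norm (f x) powr p)}"

definition L_nu_norm :: "real \<Rightarrow> real \<Rightarrow> (real \<Rightarrow> complex) \<Rightarrow> real" where
  "L_nu_norm \<nu> p f =
     (LINT x|lebesgue_on {0<..}. x powr (\<nu> * p - 1) * norm (f x) powr p) powr (1 / p)"

definition L_real :: "real \<Rightarrow> (real \<Rightarrow> complex) set" where
  "L_real q = {g. g \<in> borel_measurable lebesgue \<and> integrable lebesgue (\<lambda>t. norm (g t) powr q)}"

definition L_real_norm :: "real \<Rightarrow> (real \<Rightarrow> complex) \<Rightarrow> real" where
  "L_real_norm q g = (LINT t|lebesgue. norm (g t) powr q) powr (1 / q)"

text \<open>
  A compact linear operator from the seminormed space \<open>(V, N)\<close> to the seminormed space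
  \<open>(W, M)\<close>: every bounded sequence has a subsequence whose image converges in \<open>W\<close>.
\<close>

definition compact_linear_operator ::
  "('a \<Rightarrow> complex) set \<Rightarrow> (('a \<Rightarrow> complex) \<Rightarrow> real) \<Rightarrow>
   ('b \<Rightarrow> complex) set \<Rightarrow> (('b \<Rightarrow> complex) \<Rightarrow> real) \<Rightarrow>
   (('a \<Rightarrow> complex) \<Rightarrow> ('b \<Rightarrow> complex)) \<Rightarrow> bool" where
  "compact_linear_operator V N W M T \<longleftrightarrow>
     (\<forall>f\<in>V. T f \<in> W) \<and>
     (\<forall>f\<in>V. \<forall>g\<in>V. T (\<lambda>x. f x + g x) = (\<lambda>t. T f t + T g t)) \<and>
     (\<forall>c. \<forall>f\<in>V. T (\<lambda>x. c * f x) = (\<lambda>t. c * T f t)) \<and>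
     (\<forall>s :: nat \<Rightarrow> 'a \<Rightarrow> complex.
        (\<forall>n. s n \<in> V) \<and> (\<exists>C. \<forall>n. N (s n) \<le> C) \<longrightarrow>
        (\<exists>r g. strict_mono r \<and> g \<in> W \<and>
           (\<lambda>n. M (\<lambda>t. T (s (r n)) t - g t)) \<longlonglongrightarrow> 0))"

definition F_kernel :: "real \<Rightarrow> real \<Rightarrow> real \<Rightarrow> real" where
  "F_kernel \<alpha> \<tau> x =
     (norm (macdonald_K ((\<i> * of_real \<tau> + of_real \<alpha>) / 2) (of_real x)))\<^sup>2"

definition F_transform :: "real \<Rightarrow> (real \<Rightarrow> complex) \<Rightarrow> real \<Rightarrow> complex" where
  "F_transform \<alpha> f \<tau> = (LINT x|lebesgue_on {0<..}. of_real (F_kernel \<alpha> \<tau> x) * f x)"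

end

theory Submission
  imports Defs "HOL-Complex_Analysis.Great_Picard" "HOL-Probability.Sinc_Integral"
    "HOL-Probability.Characteristic_Functions"
begin

text \<open>
  The transform is compact because its kernel \<open>k \<tau> x = \<bar>K\<^sub>\<mu>(x)\<bar>\<^sup>2\<close>, with
  \<open>\<mu> = (\<i> \<tau> + \<alpha>) / 2\<close>, is controlled by a product of two functions of one variable. For every
  \<open>\<beta> > \<alpha>\<close> there is a constant \<open>A\<close> such that, with \<open>b x = A * x powr (-\<beta>) * exp (- x)\<close>,
  the kernel is at most \<open>b x / (1 + \<tau>\<^sup>2)\<close> and is Lipschitz in \<open>\<tau>\<close> with constant \<open>b x\<close>
  (\<open>F_kernel_bounds\<close>). The constraint \<open>\<alpha> + \<nu> < 1\<close> leaves room for some \<open>\<beta>\<close> strictly between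
  \<open>\<alpha>\<close> and \<open>1 - \<nu>\<close>, and then \<open>b\<close> lies in the weighted space dual to \<open>L_nu \<nu> p\<close>: its norm
  there is given by Euler's Gamma integral.
  
  By duality the images of a bounded sequence are all dominated by one multiple of \<open>1 / (1 + \<tau>\<^sup>2)\<close>,
  which is in \<open>L\<^sub>q\<close>, and they share a Lipschitz constant. The theorem of Arzela and Ascoli gives a
  subsequence that converges at every point, and dominated convergence makes it converge in \<open>L\<^sub>q\<close>
  (\<open>compact_integral_operator\<close>).
  
  The bounds on the kernel come from the integral
  \<open>K\<^sub>\<mu>(x) = \<integral>\<^sub>0\<^sup>\<infinity> exp (- x cosh u) cosh (\<mu> u) du\<close> (\<open>macdonald_K_bounds\<close>). Its absolute
  value is estimated directly, decay in \<open>\<tau>\<close> comes from one integration by parts, and the Lipschitz bound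
  from differencing under the integral sign. All three integrals have the same majorant
  (\<open>macdonald_integrand_majorant\<close>).
\<close>

section \<open>Estimates for the Macdonald function\<close>

text \<open>
  From \<open>t \<le> exp t\<close> with \<open>t = y / (k * s)\<close>, raised to the power \<open>s\<close>. The free parameter
  \<open>k\<close> decides how small a part of an available exponential decay is spent on absorbing a power.
\<close>

lemma powr_le_exp:
  fixes y s k :: real
  assumes "0 < y" "0 < s" "0 < k"
  shows "y powr s \<le> (k * s) powr s * exp (y / k)"
proof -
  have "y / (k * s) \<le> exp (y / (k * s))"
    using exp_ge_add_one_self[of "y / (k * s)"] by linarith
  then have "(y / (k * s)) powr s \<le> exp (y / (k * s)) powr s"
    using assms by (intro powr_mono2) auto
  also have "\<dots> = exp (y / k)"
    using assms by (simp add: powr_def)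
  finally show ?thesis
    using assms by (simp add: powr_divide field_simps)
qed

text \<open>
  The single pointwise estimate behind all bounds on \<open>macdonald_K\<close>. Half of the decay
  \<open>exp (- x * cosh u)\<close> is kept, as \<open>exp (- x / 2)\<close>; the other half absorbs the factor
  \<open>1 + x * sinh u\<close> and still leaves \<open>(x * cosh u) powr (-s)\<close>. That power supplies both the
  behaviour \<open>x powr (-s)\<close> at the origin and, by \<open>cosh u \<ge> exp u / 2\<close>, a decay
  \<open>exp (- s * u)\<close> in \<open>u\<close> that beats \<open>exp (a * u)\<close>. Half of the surplus \<open>s - a\<close>
  pays for the factor \<open>1 + u\<close>. The three weights \<open>1\<close>, \<open>u\<close> and \<open>x * sinh u\<close>, all below
  \<open>(1 + u) * (1 + x * sinh u)\<close>, occur in the integrals for \<open>K\<^sub>\<mu>\<close>, for its increments in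
  \<open>\<mu>\<close>, and for \<open>\<mu> K\<^sub>\<mu>\<close>, respectively.
\<close>

lemma macdonald_integrand_majorant:
  fixes a s :: real
  assumes "0 \<le> a" "a < s"
  shows "\<exists>C>0. \<forall>x>0. \<forall>u\<ge>0. (1 + u) * (1 + x * sinh u) * exp (- x * cosh u) * exp (a * u)
           \<le> C * (x powr (-s) * exp (- x / 2)) * exp (- ((s - a) / 2) * u)"
proof -
  define d where "d = (s - a) / 2"
  have d: "d > 0" and s: "s > 0" using assms by (auto simp: d_def)
  define C where "C = 4 * (4 * s) powr s * 2 powr s * (1 + 1 / d)"
  have "C > 0" unfolding C_def using d s by (intro mult_pos_pos add_pos_pos) auto
  moreover have "(1 + u) * (1 + x * sinh u) * exp (- x * cosh u) * exp (a * u)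
           \<le> C * (x powr (-s) * exp (- x / 2)) * exp (- d * u)" if x: "x > 0" and u: "u \<ge> 0" for x u
  proof -
    define c where "c = cosh u"
    define y where "y = x * c"
    have c1: "c \<ge> 1" and cu: "c \<ge> exp u / 2" and sc: "sinh u \<le> c" and s0: "0 \<le> sinh u"
      using cosh_real_ge_1[of u] sinh_le_cosh_real[of u] u by (auto simp: c_def cosh_def)
    have y: "y > 0" using x c1 by (auto simp: y_def)
    have yx: "y \<ge> x" using x c1 by (auto simp: y_def)
    have e1: "y powr s \<le> (4 * s) powr s * exp (y / 4)"
      using powr_le_exp[OF y s, of 4] by simp
    have e2: "1 + y \<le> 4 * exp (y / 4)"
      using exp_ge_add_one_self[of "y / 4"] y by (simp add: field_simps)
    have e3: "1 + u \<le> (1 + 1 / d) * exp (d * u)"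
    proof -
      have "d * u \<le> exp (d * u)" using exp_ge_add_one_self[of "d * u"] by linarith
      then have "u \<le> 1 / d * exp (d * u)" using d by (simp add: field_simps)
      moreover have "1 \<le> exp (d * u)" using d u by simp
      ultimately have "1 + u \<le> exp (d * u) + 1 / d * exp (d * u)" by linarith
      then show ?thesis by (simp add: distrib_right)
    qed
    have e4: "x powr s * (exp u / 2) powr s \<le> y powr s"
      using x c1 cu s by (simp add: y_def powr_mult powr_mono2 mult_left_mono)
    have "(1 + x * sinh u) * (x powr s * (exp u / 2) powr s) \<le> (1 + y) * y powr s"
      using x s0 sc e4 y by (intro mult_mono) (auto simp: y_def mult_left_mono)
    also have "\<dots> \<le> (4 * exp (y / 4)) * ((4 * s) powr s * exp (y / 4))"
      using e1 e2 y by (intro mult_mono) auto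
    also have "\<dots> = 4 * (4 * s) powr s * exp (y / 2)"
      by (simp add: mult_exp_exp)
    finally have m: "(1 + x * sinh u) * (x powr s * (exp u / 2) powr s) \<le> 4 * (4 * s) powr s * exp (y / 2)" .
    have p: "(exp u / 2) powr s = exp (s * u) / 2 powr s"
      by (simp add: powr_divide) (simp add: powr_def)
    have m2: "(1 + x * sinh u) * (x powr s * exp (s * u)) \<le> 4 * (4 * s) powr s * 2 powr s * exp (y / 2)"
      using m unfolding p by (simp add: field_simps)
    have "(1 + x * sinh u) * exp (- y) * (x powr s * exp (s * u)) \<le> 4 * (4 * s) powr s * 2 powr s * exp (y / 2) * exp (- y)"
      using mult_right_mono[OF m2, of "exp (- y)"] by (simp add: algebra_simps)
    also have "\<dots> = 4 * (4 * s) powr s * 2 powr s * exp (- y / 2)"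
      by (simp add: mult_exp_exp mult.assoc)
    also have "\<dots> \<le> 4 * (4 * s) powr s * 2 powr s * exp (- x / 2)"
      using yx s by (intro mult_left_mono) auto
    finally have m3: "(1 + x * sinh u) * exp (- y) * (x powr s * exp (s * u)) \<le> 4 * (4 * s) powr s * 2 powr s * exp (- x / 2)" .
    have m4: "(1 + u) * ((1 + x * sinh u) * exp (- y) * (x powr s * exp (s * u)))
        \<le> ((1 + 1 / d) * exp (d * u)) * (4 * (4 * s) powr s * 2 powr s * exp (- x / 2))"
      by (rule mult_mono[OF e3 m3]) (use u x s0 d in auto)
    have xs: "x powr s > 0" using x by simp
    have "(1 + u) * (1 + x * sinh u) * exp (- y) * exp (a * u)
       = (1 + u) * ((1 + x * sinh u) * exp (- y) * (x powr s * exp (s * u))) * (x powr (-s) * exp ((a - s) * u))"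
      using xs by (simp add: powr_minus field_simps mult_exp_exp flip: exp_add)
    also have "\<dots> \<le> ((1 + 1 / d) * exp (d * u)) * (4 * (4 * s) powr s * 2 powr s * exp (- x / 2)) * (x powr (-s) * exp ((a - s) * u))"
      by (intro mult_right_mono m4) auto
    also have "\<dots> = C * (x powr (-s) * exp (- x / 2)) * exp (d * u + (a - s) * u)"
      unfolding exp_add C_def by (simp add: field_simps)
    also have "d * u + (a - s) * u = - d * u" by (simp add: d_def field_simps)
    finally show ?thesis by (simp add: y_def c_def)
  qed
  ultimately show ?thesis unfolding d_def by blast
qed

lemma set_integral_exponential_bound:
  fixes g :: "real \<Rightarrow> complex"
  assumes "continuous_on {0..} g" "d > 0" "\<And>u. u \<ge> 0 \<Longrightarrow> norm (g u) \<le> D * exp (- d * u)"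
  shows "set_integrable lebesgue {0..} g" "norm (LINT u:{0..}|lebesgue. g u) \<le> D / d"
proof -
  have E: "set_integrable lebesgue {0..} (\<lambda>u::real. D * exp (- d * u))"
    using assms(2) by (intro set_integrable_mult_right nonnegative_absolutely_integrable_1 integrable_on_exp_minus_to_infinity) auto
  have m: "set_borel_measurable lebesgue {0..} g"
    using assms(1) unfolding set_borel_measurable_def
    by (intro measurable_completion) (auto intro!: borel_measurable_continuous_on_indicator)
  show I: "set_integrable lebesgue {0..} g"
    by (rule set_integrable_bound[OF E m]) (use assms(3) in force)
  have "norm (LINT u:{0..}|lebesgue. g u) \<le> (LINT u:{0..}|lebesgue. norm (g u))"
    by (rule set_integral_norm_bound[OF I])
  also have "\<dots> \<le> (LINT u:{0..}|lebesgue. D * exp (- d * u))"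
    by (intro set_integral_mono set_integrable_norm I E) (use assms(3) in auto)
  also have "\<dots> = D * (LINT u:{0..}|lebesgue. exp (- d * u))" by simp
  also have "(LINT u:{0..}|lebesgue. exp (- d * u)) = 1 / d"
  proof (subst set_lebesgue_integral_eq_integral)
    show "set_integrable lebesgue {0..} (\<lambda>u::real. exp (- d * u))"
     using assms(2) by (intro nonnegative_absolutely_integrable_1 integrable_on_exp_minus_to_infinity) auto
    show "integral {0..} (\<lambda>u. exp (- d * u)) = 1 / d"
      using has_integral_exp_minus_to_infinity[OF assms(2), of 0] by (simp add: integral_unique)
  qed
  finally show "norm (LINT u:{0..}|lebesgue. g u) \<le> D / d" by simp
qed

text \<open>
  On a vertical line \<open>exp\<close> differs from a rotation only by a constant factor, and
  \<open>\<theta> \<mapsto> exp (\<i> \<theta>)\<close> is Lipschitz with constant 1.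
\<close>

lemma norm_exp_diff_same_Re:
  fixes z w :: complex
  assumes "Re z = Re w"
  shows "norm (exp z - exp w) \<le> exp (Re w) * norm (z - w)"
proof -
  have zw: "norm (z - w) = \<bar>Im z - Im w\<bar>"
    using assms by (simp add: cmod_def)
  have "z = w + \<i> * of_real (Im z - Im w)"
    using assms by (simp add: complex_eq_iff)
  then have "exp z = exp w * exp (\<i> * of_real (Im z - Im w))"
    by (metis exp_add)
  then have "exp z - exp w = exp w * (exp (\<i> * of_real (Im z - Im w)) - 1)"
    by (simp add: right_diff_distrib)
  moreover have "norm (exp (\<i> * of_real (Im z - Im w)) - 1) \<le> \<bar>Im z - Im w\<bar>"
    using iexp_approx1[of "Im z - Im w" 0] by simp
  ultimately show ?thesis
    unfolding zw by (simp add: norm_mult mult_left_mono)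
qed

lemma norm_cosh_sinh_le:
  fixes z :: complex
  assumes "Re z \<ge> 0"
  shows "norm (cosh z) \<le> exp (Re z)" "norm (sinh z) \<le> exp (Re z)"
proof -
  have "exp (- Re z) \<le> exp (Re z)" using assms by simp
  then have e: "norm (exp z) + norm (exp (-z)) \<le> 2 * exp (Re z)" by simp
  show "norm (cosh z) \<le> exp (Re z)"
    using order_trans[OF norm_triangle_ineq e] by (simp add: cosh_def scaleR_conv_of_real norm_divide)
  show "norm (sinh z) \<le> exp (Re z)"
    using order_trans[OF norm_triangle_ineq4 e] by (simp add: sinh_def scaleR_conv_of_real norm_divide)
qed

lemma norm_cosh_diff_le:
  fixes z w :: complex
  assumes "Re z = Re w" "Re w \<ge> 0"
  shows "norm (cosh z - cosh w) \<le> exp (Re w) * norm (z - w)"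
proof -
  have "norm (exp z - exp w) \<le> exp (Re w) * norm (z - w)"
    by (rule norm_exp_diff_same_Re) fact
  moreover have "norm (exp (-z) - exp (-w)) \<le> exp (Re w) * norm (z - w)"
  proof -
    have "norm (exp (-z) - exp (-w)) \<le> exp (- Re w) * norm (z - w)"
      using norm_exp_diff_same_Re[of "-z" "-w"] assms(1) by (simp add: norm_minus_commute)
    also have "\<dots> \<le> exp (Re w) * norm (z - w)"
      using assms(2) by (intro mult_right_mono) auto
    finally show ?thesis .
  qed
  ultimately have "norm ((exp z - exp w) + (exp (-z) - exp (-w))) \<le> 2 * (exp (Re w) * norm (z - w))"
    using norm_triangle_ineq[of "exp z - exp w" "exp (-z) - exp (-w)"] by linarith
  moreover have "cosh z - cosh w = ((exp z - exp w) + (exp (-z) - exp (-w))) / 2"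
    by (simp add: cosh_def field_simps scaleR_conv_of_real)
  ultimately show ?thesis
    by (simp only: norm_divide) simp
qed

lemma of_real_cosh: "complex_of_real (cosh u) = cosh (of_real u)"
  by (simp add: cosh_def scaleR_conv_of_real flip: exp_of_real)

lemma of_real_sinh: "complex_of_real (sinh u) = sinh (of_real u)"
  by (simp add: sinh_def scaleR_conv_of_real flip: exp_of_real)

text \<open>
  On the line \<open>Re \<mu> = a\<close> the bounds are uniform in \<open>\<mu>\<close>. Since
  \<open>\<bar>cosh (\<mu> u)\<bar> \<le> exp (a u)\<close>, the first one bounds the defining integral absolutely, and the third one
  does the same for the difference of two such integrals. The second one supplies the decay in \<open>\<mu>\<close>:
  integration by parts against \<open>d/du sinh (\<mu> u) = \<mu> cosh (\<mu> u)\<close> gives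
  \<open>\<mu> K\<^sub>\<mu>(x) = \<integral>\<^sub>0\<^sup>\<infinity> x sinh u exp (- x cosh u) sinh (\<mu> u) du\<close>, an integral with the same majorant.
  (The true decay is exponential, but obtaining it requires a rotation of the contour; one power of
  \<open>\<bar>\<mu>\<bar>\<close> suffices here.)
\<close>

lemma macdonald_K_bounds:
  fixes a s :: real
  assumes a0: "0 \<le> a" and "a < s"
  shows "\<exists>C>0. \<forall>x>0. \<forall>\<mu>. Re \<mu> = a \<longrightarrow>
    norm (macdonald_K \<mu> (of_real x)) \<le> C * (x powr (-s) * exp (- x / 2)) \<and>
    norm \<mu> * norm (macdonald_K \<mu> (of_real x)) \<le> C * (x powr (-s) * exp (- x / 2)) \<and>
    (\<forall>\<mu>'. Re \<mu>' = a \<longrightarrow> norm (macdonald_K \<mu> (of_real x) - macdonald_K \<mu>' (of_real x))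
       \<le> norm (\<mu> - \<mu>') * (C * (x powr (-s) * exp (- x / 2))))"
proof -
  define d where "d = (s - a) / 2"
  have d: "d > 0" using assms by (simp add: d_def)
  obtain C where C: "C > 0" and maj: "\<And>x u. x > 0 \<Longrightarrow> u \<ge> 0 \<Longrightarrow>
      (1 + u) * (1 + x * sinh u) * exp (- x * cosh u) * exp (a * u)
           \<le> C * (x powr (-s) * exp (- x / 2)) * exp (- d * u)"
    using macdonald_integrand_majorant[OF assms] unfolding d_def by blast
  have "norm (macdonald_K \<mu> (of_real x)) \<le> C / d * (x powr (-s) * exp (- x / 2)) \<and>
    norm \<mu> * norm (macdonald_K \<mu> (of_real x)) \<le> C / d * (x powr (-s) * exp (- x / 2)) \<and>
    (\<forall>\<mu>'. Re \<mu>' = a \<longrightarrow> norm (macdonald_K \<mu> (of_real x) - macdonald_K \<mu>' (of_real x))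
       \<le> norm (\<mu> - \<mu>') * (C / d * (x powr (-s) * exp (- x / 2))))"
    if x: "x > 0" and \<mu>: "Re \<mu> = a" for x \<mu>
  proof -
    define B where "B = C * (x powr (-s) * exp (- x / 2))"
    have maj_le: "w * (exp (- x * cosh u) * exp (a * u)) \<le> B * exp (- d * u)"
      if "u \<ge> 0" "w \<le> (1 + u) * (1 + x * sinh u)" for w u
    proof -
      have "w * (exp (- x * cosh u) * exp (a * u))
          \<le> (1 + u) * (1 + x * sinh u) * (exp (- x * cosh u) * exp (a * u))"
        using that by (intro mult_right_mono) auto
      also have "\<dots> \<le> B * exp (- d * u)"
        using maj[OF x that(1)] by (simp add: B_def mult.assoc)
      finally show ?thesis .
    qed
    have weights: "1 \<le> (1 + u) * (1 + x * sinh u)" "u \<le> (1 + u) * (1 + x * sinh u)"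
       "x * sinh u \<le> (1 + u) * (1 + x * sinh u)" if "u \<ge> 0" for u
      using that x by (simp_all add: algebra_simps add_nonneg_nonneg)
    define E where "E u = exp (- of_real x * of_real (cosh u) :: complex)" for u
    have normE: "norm (E u) = exp (- x * cosh u)" for u by (simp add: E_def)
    have contE [continuous_intros]: "continuous_on S E" for S
      unfolding E_def by (intro continuous_intros)
    have K: "macdonald_K \<mu>' (of_real x) = (LINT u:{0..}|lebesgue. E u * cosh (\<mu>' * of_real u))" for \<mu>'
      by (simp add: macdonald_K_def E_def)
    have bK: "norm (E u * cosh (\<mu>' * of_real u)) \<le> B * exp (- d * u)"
      if "u \<ge> 0" "Re \<mu>' = a" for u \<mu>'
    proof -
      have "norm (cosh (\<mu>' * of_real u)) \<le> exp (a * u)"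
        using norm_cosh_sinh_le(1)[of "\<mu>' * of_real u"] that a0 by simp
      then have "norm (E u * cosh (\<mu>' * of_real u)) \<le> 1 * (exp (- x * cosh u) * exp (a * u))"
        by (simp add: norm_mult normE mult_left_mono)
      also have "\<dots> \<le> B * exp (- d * u)" using that by (intro maj_le weights) auto
      finally show ?thesis .
    qed
    have cK: "continuous_on {0..} (\<lambda>u. E u * cosh (\<mu>' * of_real u))" for \<mu>'
      by (intro continuous_intros)
    note iK = set_integral_exponential_bound[OF cK d bK]
    have "norm (macdonald_K \<mu> (of_real x)) \<le> B / d"
      unfolding K by (rule iK(2)) (use \<mu> in auto)
    moreover have "norm (macdonald_K \<mu> (of_real x) - macdonald_K \<mu>' (of_real x))
        \<le> norm (\<mu> - \<mu>') * (B / d)" if \<mu>': "Re \<mu>' = a" for \<mu>'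
    proof -
      have "macdonald_K \<mu> (of_real x) - macdonald_K \<mu>' (of_real x) =
          (LINT u:{0..}|lebesgue. E u * cosh (\<mu> * of_real u) - E u * cosh (\<mu>' * of_real u))"
        unfolding K by (intro set_integral_diff(2)[symmetric] iK(1)) (use \<mu> \<mu>' in auto)
      also have "norm \<dots> \<le> (norm (\<mu> - \<mu>') * B) / d"
      proof (rule set_integral_exponential_bound(2)[OF _ d])
        show "continuous_on {0..} (\<lambda>u. E u * cosh (\<mu> * of_real u) - E u * cosh (\<mu>' * of_real u))"
          by (intro continuous_intros)
        show "norm (E u * cosh (\<mu> * of_real u) - E u * cosh (\<mu>' * of_real u))
            \<le> norm (\<mu> - \<mu>') * B * exp (- d * u)" if u: "u \<ge> 0" for u
        proof -
          have "norm (cosh (\<mu> * of_real u) - cosh (\<mu>' * of_real u))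
              \<le> exp (a * u) * norm (\<mu> * of_real u - \<mu>' * of_real u)"
            using norm_cosh_diff_le[of "\<mu> * of_real u" "\<mu>' * of_real u"] \<mu> \<mu>' u a0 by simp
          also have "norm (\<mu> * of_real u - \<mu>' * of_real u) = norm (\<mu> - \<mu>') * u"
            using u by (simp flip: left_diff_distrib add: norm_mult)
          finally have "norm (E u) * norm (cosh (\<mu> * of_real u) - cosh (\<mu>' * of_real u))
              \<le> exp (- x * cosh u) * (exp (a * u) * (norm (\<mu> - \<mu>') * u))"
            unfolding normE by (intro mult_left_mono) auto
          also have "\<dots> = norm (\<mu> - \<mu>') * (u * (exp (- x * cosh u) * exp (a * u)))" by simp
          also have "\<dots> \<le> norm (\<mu> - \<mu>') * (B * exp (- d * u))"
            using u by (intro mult_left_mono maj_le weights) auto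
          finally show ?thesis by (simp add: norm_mult flip: right_diff_distrib)
        qed
      qed
      finally show ?thesis by simp
    qed
    moreover have "norm \<mu> * norm (macdonald_K \<mu> (of_real x)) \<le> B / d"
    proof -
      \<comment> \<open>\<open>f\<close> is the derivative of \<open>F\<close>, which vanishes at \<open>0\<close> and at infinity; so the
        integral of \<open>f\<close> over the half-line is zero.\<close>
      define h where "h u = of_real (x * sinh u) * E u * sinh (\<mu> * of_real u)" for u
      define F where "F u = E u * sinh (\<mu> * of_real u)" for u
      have ch: "continuous_on {0..} h"
        unfolding h_def by (intro continuous_intros)
      have bF: "norm (F u) \<le> exp (- x * cosh u) * exp (a * u)" if "u \<ge> 0" for u
        using norm_cosh_sinh_le(2)[of "\<mu> * of_real u"] that \<mu> a0
        by (simp add: F_def norm_mult normE mult_left_mono)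
      have bh: "norm (h u) \<le> B * exp (- d * u)" if u: "u \<ge> 0" for u
      proof -
        have "norm (h u) = (x * sinh u) * norm (F u)"
          using u x by (simp add: h_def F_def norm_mult)
        also have "\<dots> \<le> (x * sinh u) * (exp (- x * cosh u) * exp (a * u))"
          using bF[OF u] u x by (intro mult_left_mono) auto
        also have "\<dots> \<le> B * exp (- d * u)" using u by (intro maj_le weights)
        finally show ?thesis .
      qed
      note ih = set_integral_exponential_bound[OF ch d bh]
      define f where "f u = \<mu> * (E u * cosh (\<mu> * of_real u)) - h u" for u
      have iK1: "set_integrable lebesgue {0..} (\<lambda>u. E u * cosh (\<mu> * of_real u))"
        by (rule iK(1)) (use \<mu> in auto)
      have fi: "set_integrable lebesgue {0..} f"
        unfolding f_def by (intro set_integral_diff(1) ih(1) set_integrable_mult_right iK1)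
      have f_eq: "(LINT u:{0..}|lebesgue. f u) = \<mu> * macdonald_K \<mu> (of_real x) - (LINT u:{0..}|lebesgue. h u)"
        unfolding f_def K by (subst set_integral_diff(2)) (auto intro!: ih(1) iK1)
      have part: "(LINT u:{0..b}|lebesgue. f u) = F b" if b: "b \<ge> 0" for b
      proof -
        have "(F has_vector_derivative f u) (at u within {0..b})" for u
        proof -
          have "((\<lambda>z. exp (- of_real x * cosh z) * sinh (\<mu> * z)) has_field_derivative
             \<mu> * (exp (- of_real x * cosh (of_real u)) * cosh (\<mu> * of_real u))
              - of_real x * sinh (of_real u) * exp (- of_real x * cosh (of_real u)) * sinh (\<mu> * of_real u)) (at (of_real u))"
            by (auto intro!: derivative_eq_intros simp: algebra_simps)
          from has_vector_derivative_real_field[OF this, of "{0..b}"]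
          show ?thesis
            by (simp add: F_def[abs_def] f_def h_def E_def of_real_cosh of_real_sinh mult.assoc)
        qed
        then have "(f has_integral (F b - F 0)) {0..b}"
          using b by (intro fundamental_theorem_of_calculus)
        moreover have "set_integrable lebesgue {0..b} f"
          by (rule set_integrable_subset[OF fi]) auto
        ultimately show ?thesis
          by (simp add: set_lebesgue_integral_eq_integral integral_unique F_def)
      qed
      have "((\<lambda>b. LINT u:{0..b}|lebesgue. f u) \<longlongrightarrow> (LINT u:{0..}|lebesgue. f u)) at_top"
        by (rule tendsto_set_lebesgue_integral_at_top) (auto intro: fi)
      moreover have "((\<lambda>b. LINT u:{0..b}|lebesgue. f u) \<longlongrightarrow> 0) at_top"
      proof (rule Lim_null_comparison)
        show "\<forall>\<^sub>F b in at_top. norm (LINT u:{0..b}|lebesgue. f u) \<le> B * exp (- d * b)"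
        proof (rule eventually_mono[OF eventually_ge_at_top[of 0]])
          fix b :: real assume b: "0 \<le> b"
          have "norm (F b) \<le> 1 * (exp (- x * cosh b) * exp (a * b))" using bF[OF b] by simp
          also have "\<dots> \<le> B * exp (- d * b)" using b by (intro maj_le weights)
          finally show "norm (LINT u:{0..b}|lebesgue. f u) \<le> B * exp (- d * b)" using part[OF b] by simp
        qed
        show "((\<lambda>b. B * exp (- d * b)) \<longlongrightarrow> 0) at_top"
          using d by real_asymp
      qed
      ultimately have "(LINT u:{0..}|lebesgue. f u) = 0"
        by (rule tendsto_unique[rotated]) simp
      then have "\<mu> * macdonald_K \<mu> (of_real x) = (LINT u:{0..}|lebesgue. h u)" using f_eq by simp
      then show ?thesis using ih(2) by (simp flip: norm_mult)
    qed
    ultimately show ?thesis by (simp add: B_def)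
  qed
  then show ?thesis using C d by (intro exI[of _ "C / d"]) auto
qed

text \<open>
  The kernel is a square, so it has twice the singularity and twice the decay of
  \<open>K\<^sub>\<mu>\<close>: the order \<open>a = \<alpha> / 2\<close> becomes \<open>\<alpha>\<close>, the exponent \<open>s = \<beta> / 2\<close> becomes
  \<open>\<beta>\<close>, and the factor \<open>1 / \<bar>\<mu>\<bar>\<close> becomes \<open>1 / \<tau>\<^sup>2\<close>, because \<open>\<bar>\<tau>\<bar> \<le> 2 \<bar>\<mu>\<bar>\<close>.
  The Lipschitz bound comes from \<open>N\<^sup>2 - N'\<^sup>2 = (N - N') (N + N')\<close>.
\<close>

lemma F_kernel_bounds:
  fixes \<alpha> \<beta> :: real
  assumes "0 \<le> \<alpha>" "\<alpha> < \<beta>"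
  shows "\<exists>A>0. \<forall>x>0. \<forall>\<tau>. F_kernel \<alpha> \<tau> x \<le> A * (x powr (-\<beta>) * exp (- x)) / (1 + \<tau>\<^sup>2) \<and>
    (\<forall>\<tau>'. \<bar>F_kernel \<alpha> \<tau> x - F_kernel \<alpha> \<tau>' x\<bar> \<le> \<bar>\<tau> - \<tau>'\<bar> * (A * (x powr (-\<beta>) * exp (- x))))"
proof -
  obtain C where C: "C > 0" and bounds: "\<And>x \<mu>. x > 0 \<Longrightarrow> Re \<mu> = \<alpha> / 2 \<Longrightarrow>
    norm (macdonald_K \<mu> (of_real x)) \<le> C * (x powr (-(\<beta>/2)) * exp (- x / 2)) \<and>
    norm \<mu> * norm (macdonald_K \<mu> (of_real x)) \<le> C * (x powr (-(\<beta>/2)) * exp (- x / 2)) \<and>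
    (\<forall>\<mu>'. Re \<mu>' = \<alpha> / 2 \<longrightarrow> norm (macdonald_K \<mu> (of_real x) - macdonald_K \<mu>' (of_real x))
       \<le> norm (\<mu> - \<mu>') * (C * (x powr (-(\<beta>/2)) * exp (- x / 2))))"
    using macdonald_K_bounds[of "\<alpha> / 2" "\<beta> / 2"] assms by auto
  have "F_kernel \<alpha> \<tau> x \<le> 5 * C\<^sup>2 * (x powr (-\<beta>) * exp (- x)) / (1 + \<tau>\<^sup>2) \<and>
    (\<forall>\<tau>'. \<bar>F_kernel \<alpha> \<tau> x - F_kernel \<alpha> \<tau>' x\<bar> \<le> \<bar>\<tau> - \<tau>'\<bar> * (5 * C\<^sup>2 * (x powr (-\<beta>) * exp (- x))))"
    if x: "x > 0" for x \<tau>
  proof -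
    define D where "D = C * (x powr (-(\<beta>/2)) * exp (- x / 2))"
    have D0: "D > 0" using C x by (simp add: D_def)
    have D2: "D\<^sup>2 = C\<^sup>2 * (x powr (-\<beta>) * exp (- x))"
    proof -
      have "(x powr (-(\<beta>/2)))\<^sup>2 = x powr (-\<beta>)" "(exp (- x / 2))\<^sup>2 = exp (- x)"
        using x by (simp_all add: power2_eq_square flip: powr_add exp_add)
      then show ?thesis by (simp add: D_def power_mult_distrib)
    qed
    define m where "m t = (\<i> * of_real t + of_real \<alpha>) / 2" for t :: real
    define N where "N t = norm (macdonald_K (m t) (of_real x))" for t
    have F: "F_kernel \<alpha> t x = (N t)\<^sup>2" for t by (simp add: F_kernel_def N_def m_def)
    have mRe: "Re (m t) = \<alpha> / 2" for t by (simp add: m_def)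
    have mIm: "\<bar>t\<bar> \<le> 2 * norm (m t)" for t
      using abs_Im_le_cmod[of "m t"] by (simp add: m_def)
    have mdiff: "norm (m t - m t') = \<bar>t - t'\<bar> / 2" for t t'
    proof -
      have "m t - m t' = \<i> * of_real (t - t') / 2" by (simp add: m_def field_simps)
      then have "norm (m t - m t') = norm (\<i> * of_real (t - t') / 2)" by (simp only:)
      then show ?thesis by (simp add: norm_mult norm_divide del: of_real_diff)
    qed
    have N0: "0 \<le> N t" for t by (simp add: N_def)
    have N1: "N t \<le> D" for t using bounds[OF x mRe] by (auto simp: N_def D_def)
    have N2: "norm (m t) * N t \<le> D" for t using bounds[OF x mRe] by (auto simp: N_def D_def)
    have N3: "\<bar>N t - N t'\<bar> \<le> \<bar>t - t'\<bar> / 2 * D" for t t'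
    proof -
      have "\<bar>N t - N t'\<bar> \<le> norm (macdonald_K (m t) (of_real x) - macdonald_K (m t') (of_real x))"
        unfolding N_def by (rule norm_triangle_ineq3)
      also have "\<dots> \<le> norm (m t - m t') * D"
        using bounds[OF x mRe] mRe by (auto simp: D_def)
      finally show ?thesis by (simp add: mdiff)
    qed
    \<comment> \<open>The constant \<open>5\<close> is \<open>1 + 2\<^sup>2\<close>: \<open>D\<^sup>2\<close> bounds the part without \<open>\<tau>\<close>, and
      \<open>(2 * D)\<^sup>2\<close> the part with \<open>\<tau>\<^sup>2\<close>.\<close>
    have "(N \<tau>)\<^sup>2 * (1 + \<tau>\<^sup>2) \<le> 5 * D\<^sup>2"
    proof -
      have "\<bar>\<tau>\<bar> * N \<tau> \<le> 2 * norm (m \<tau>) * N \<tau>" by (intro mult_right_mono mIm N0)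
      also have "\<dots> \<le> 2 * D" using N2[of \<tau>] by simp
      finally have "(\<bar>\<tau>\<bar> * N \<tau>)\<^sup>2 \<le> (2 * D)\<^sup>2" using N0 by (intro power_mono) auto
      moreover have "(N \<tau>)\<^sup>2 \<le> D\<^sup>2" using N0 N1 by (intro power_mono) auto
      ultimately show ?thesis by (simp add: power_mult_distrib algebra_simps)
    qed
    then have "F_kernel \<alpha> \<tau> x \<le> 5 * D\<^sup>2 / (1 + \<tau>\<^sup>2)"
      unfolding F by (simp add: pos_le_divide_eq add_pos_nonneg)
    moreover have "\<bar>F_kernel \<alpha> \<tau> x - F_kernel \<alpha> \<tau>' x\<bar> \<le> \<bar>\<tau> - \<tau>'\<bar> * (5 * D\<^sup>2)" for \<tau>'
    proof -
      have "\<bar>(N \<tau>)\<^sup>2 - (N \<tau>')\<^sup>2\<bar> = \<bar>N \<tau> - N \<tau>'\<bar> * (N \<tau> + N \<tau>')"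
        using N0[of \<tau>] N0[of \<tau>'] by (simp add: power2_eq_square square_diff_square_factored abs_mult)
      also have "\<dots> \<le> (\<bar>\<tau> - \<tau>'\<bar> / 2 * D) * (D + D)"
        using N0 N1 N3 D0 by (intro mult_mono add_mono add_nonneg_nonneg) auto
      also have "\<dots> = \<bar>\<tau> - \<tau>'\<bar> * D\<^sup>2" by (simp add: power2_eq_square)
      also have "\<dots> \<le> \<bar>\<tau> - \<tau>'\<bar> * (5 * D\<^sup>2)" by (intro mult_left_mono) auto
      finally show ?thesis unfolding F .
    qed
    ultimately show ?thesis unfolding D2 by (simp add: mult.assoc)
  qed
  then show ?thesis using C by (intro exI[of _ "5 * C\<^sup>2"]) auto
qed

text \<open>
  The integrand is jointly Borel measurable in \<open>(x, u)\<close>, so measurability in \<open>x\<close> is part of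
  Fubini's theorem; for that the completed measure has to be replaced by \<open>lborel\<close>.
\<close>

lemma F_kernel_measurable: "F_kernel \<alpha> \<tau> \<in> borel_measurable (lebesgue_on {0<..})"
proof -
  have K: "macdonald_K \<mu> (of_real x) = (LINT u|lborel. indicator {0..} u *\<^sub>R
      (exp (- of_real x * of_real (cosh u)) * cosh (\<mu> * of_real u)))" for \<mu> and x :: real
    unfolding macdonald_K_def set_lebesgue_integral_def
    by (intro integral_completion)
       (auto intro!: borel_measurable_continuous_on_indicator continuous_intros)
  have c: "cosh = (\<lambda>z::complex. (exp z + exp (-z)) / 2)"
    by (auto simp: cosh_def scaleR_conv_of_real)
  have m: "(\<lambda>x. macdonald_K \<mu> (of_real x)) \<in> borel_measurable borel" for \<mu>
    unfolding K
    by (rule lborel.borel_measurable_lebesgue_integral)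
       (simp add: split_beta c cosh_def[where 'a=real])
  show ?thesis
    unfolding F_kernel_def[abs_def]
    by (rule measurable_restrict_space1, rule measurable_completion) (use m in simp)
qed

section \<open>Compact integral operators into L_q\<close>

text \<open>
  An Arzela-Ascoli argument on the whole line. A diagonal subsequence converges at all rational points, the
  common Lipschitz constant extends this to every real point, and the common majorant turns pointwise
  convergence into convergence in \<open>L\<^sub>q\<close> by dominated convergence.
\<close>

lemma equilipschitz_dominated_Lq_subsequence:
  fixes h :: "nat \<Rightarrow> real \<Rightarrow> complex"
  assumes q: "q > 0"
    and dom: "\<And>n t. norm (h n t) \<le> a t"
    and bnd: "\<And>t. a t \<le> M"
    and lip: "\<And>n t t'. norm (h n t - h n t') \<le> L * \<bar>t - t'\<bar>"
    and a_int: "integrable lebesgue (\<lambda>t. a t powr q)"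
  shows "\<exists>r g. strict_mono r \<and> g \<in> L_real q \<and> (\<lambda>n. L_real_norm q (\<lambda>t. h (r n) t - g t)) \<longlonglongrightarrow> 0"
proof -
  have a0: "0 \<le> a t" for t using dom[of 0 t] norm_ge_zero order_trans by blast
  have L0: "L \<ge> 0" using order_trans[OF norm_ge_zero lip[of 0 1 0]] by simp
  have hM: "norm (h n t) \<le> M" if "t \<in> \<rat>" for n t
    using dom[of n t] bnd[of t] by linarith
  obtain r where r: "strict_mono (r :: nat \<Rightarrow> nat)"
    and conv_rat: "\<And>t. t \<in> \<rat> \<Longrightarrow> \<exists>l. (\<lambda>n. h (r n) t) \<longlonglongrightarrow> l"
    by (rule function_convergent_subsequence[OF countable_rat, of h M]) (rule hM, assumption, rule that, assumption, blast)
  have "Cauchy (\<lambda>n. h (r n) t)" for t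
  proof (rule metric_CauchyI)
    fix e :: real assume e: "e > 0"
    \<comment> \<open>\<open>L + 1\<close> rather than \<open>L\<close>, since \<open>L\<close> may be zero.\<close>
    define \<delta> where "\<delta> = e / (3 * (L + 1))"
    have \<delta>: "\<delta> > 0" using e L0 by (simp add: \<delta>_def)
    obtain t' where t': "t' \<in> \<rat>" "t - \<delta> < t'" "t' < t + \<delta>"
      using Rats_dense_in_real[of "t - \<delta>" "t + \<delta>"] \<delta> by auto
    have close: "dist (h (r n) t) (h (r n) t') < e / 3" for n
    proof -
      have "dist (h (r n) t) (h (r n) t') \<le> L * \<bar>t - t'\<bar>" using lip by (simp add: dist_norm)
      also have "\<dots> \<le> L * \<delta>" using t' L0 by (intro mult_left_mono) auto
      also have "\<dots> < (L + 1) * \<delta>" using \<delta> by simp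
      also have "\<dots> = e / 3" using L0 by (simp add: \<delta>_def field_simps)
      finally show ?thesis .
    qed
    have "Cauchy (\<lambda>n. h (r n) t')"
      using conv_rat[OF t'(1)] LIMSEQ_imp_Cauchy by blast
    then obtain N where N: "\<And>m n. m \<ge> N \<Longrightarrow> n \<ge> N \<Longrightarrow> dist (h (r m) t') (h (r n) t') < e / 3"
      using e unfolding Cauchy_def by (meson divide_pos_pos zero_less_numeral)
    have "dist (h (r m) t) (h (r n) t) < e" if "m \<ge> N" "n \<ge> N" for m n
      using close[of m] close[of n] N[OF that] dist_commute[of "h (r n) t'" "h (r n) t"]
        dist_triangle[of "h (r m) t" "h (r n) t" "h (r m) t'"]
        dist_triangle[of "h (r m) t'" "h (r n) t" "h (r n) t'"] by linarith
    then show "\<exists>N. \<forall>m\<ge>N. \<forall>n\<ge>N. dist (h (r m) t) (h (r n) t) < e" by blast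
  qed
  then have "\<forall>t. \<exists>l. (\<lambda>n. h (r n) t) \<longlonglongrightarrow> l"
    using Cauchy_convergent convergent_def by blast
  then obtain g where g: "\<And>t. (\<lambda>n. h (r n) t) \<longlonglongrightarrow> g t" by metis
  have "L-lipschitz_on UNIV (h n)" for n
    using lip L0 by (intro lipschitz_onI) (auto simp: dist_norm)
  then have "continuous_on UNIV (h n)" for n by (rule lipschitz_on_continuous_on)
  then have hm: "h n \<in> borel_measurable borel" for n
    by (rule borel_measurable_continuous_onI)
  have gm: "g \<in> borel_measurable borel"
    using hm g by (rule borel_measurable_LIMSEQ_metric)
  have ga: "norm (g t) \<le> a t" for t
    using dom by (intro LIMSEQ_le_const2[OF tendsto_norm[OF g]]) auto
  have hL [measurable]: "h n \<in> borel_measurable lebesgue" for n by (rule measurable_completion) (use hm in simp)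
  have gL [measurable]: "g \<in> borel_measurable lebesgue" by (rule measurable_completion) (use gm in simp)
  have gq: "integrable lebesgue (\<lambda>t. norm (g t) powr q)"
    using q ga by (intro Bochner_Integration.integrable_bound[OF a_int]) (auto intro!: powr_mono2)
  have "(\<lambda>n. LINT t|lebesgue. norm (h (r n) t - g t) powr q) \<longlonglongrightarrow> (LINT t|(lebesgue::real measure). 0)"
  proof (rule integral_dominated_convergence[where w = "\<lambda>t. 2 powr q * a t powr q"])
    show "integrable lebesgue (\<lambda>t. 2 powr q * a t powr q)" using a_int by simp
    show "AE t in lebesgue. (\<lambda>n. norm (h (r n) t - g t) powr q) \<longlonglongrightarrow> 0"
    proof (rule AE_I2)
      fix t
      have "(\<lambda>n. norm (h (r n) t - g t)) \<longlonglongrightarrow> 0"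
        using g LIM_zero tendsto_norm_zero by blast
      then show "(\<lambda>n. norm (h (r n) t - g t) powr q) \<longlonglongrightarrow> 0"
        using q by (auto intro!: tendsto_zero_powrI)
    qed
    show "AE t in lebesgue. norm (norm (h (r n) t - g t) powr q) \<le> 2 powr q * a t powr q" for n
    proof (rule AE_I2)
      fix t
      have "norm (h (r n) t - g t) \<le> 2 * a t"
        using norm_triangle_ineq4[of "h (r n) t" "g t"] dom[of "r n" t] ga[of t] by linarith
      then have "norm (h (r n) t - g t) powr q \<le> (2 * a t) powr q"
        using q by (intro powr_mono2) auto
      then show "norm (norm (h (r n) t - g t) powr q) \<le> 2 powr q * a t powr q"
        using a0 by (simp add: powr_mult)
    qed
  qed simp_all
  then have "(\<lambda>n. L_real_norm q (\<lambda>t. h (r n) t - g t)) \<longlonglongrightarrow> 0"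
    unfolding L_real_norm_def using q
    by (intro tendsto_zero_powrI[where b = "1 / q"]) auto
  moreover have "g \<in> L_real q" using gq gL by (simp add: L_real_def)
  ultimately show ?thesis using r by blast
qed

text \<open>
  Young's inequality for the factors \<open>x powr (\<nu> - 1 / p) * norm (f x)\<close> and
  \<open>x powr (1 / p - \<nu>) * b x\<close>, whose \<open>p\<close>-th and \<open>q\<close>-th powers are the two integrands on the
  right. Integrated, it gives an additive substitute for Hoelder's inequality; that is enough wherever only
  boundedness on norm-bounded sets of \<open>f\<close> matters.
\<close>

lemma weighted_young_pairing:
  fixes b :: "real \<Rightarrow> real"
  assumes p: "1 < p" and q: "q = p / (p - 1)"
    and bm: "b \<in> borel_measurable (lebesgue_on {0<..})" and b0: "\<And>x. x > 0 \<Longrightarrow> 0 \<le> b x"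
    and b_int: "integrable (lebesgue_on {0<..}) (\<lambda>x. x powr ((1 - \<nu>) * q - 1) * b x powr q)"
    and f: "f \<in> L_nu \<nu> p"
  shows "integrable (lebesgue_on {0<..}) (\<lambda>x. b x * norm (f x))"
    "(LINT x|lebesgue_on {0<..}. b x * norm (f x)) \<le> L_nu_norm \<nu> p f powr p / p +
       (LINT x|lebesgue_on {0<..}. x powr ((1 - \<nu>) * q - 1) * b x powr q) / q"
proof -
  let ?M = "lebesgue_on {0<..} :: real measure"
  let ?F = "\<lambda>x. x powr (\<nu> * p - 1) * norm (f x) powr p"
  let ?G = "\<lambda>x. x powr ((1 - \<nu>) * q - 1) * b x powr q"
  have q1: "q > 1" and pq: "1 / p + 1 / q = 1"
    using p by (auto simp: q less_divide_eq diff_divide_distrib)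
  have qp: "q / p = q - 1" using p q by (simp add: field_simps)
  have fm: "f \<in> borel_measurable ?M" and f_int: "integrable ?M ?F" using f by (auto simp: L_nu_def)
  have young: "b x * norm (f x) \<le> ?F x / p + ?G x / q" if x: "x > 0" for x
  proof -
    have "(x powr (\<nu> - 1 / p) * norm (f x)) * (x powr (1 / p - \<nu>) * b x)
       \<le> (x powr (\<nu> - 1 / p) * norm (f x)) powr p / p + (x powr (1 / p - \<nu>) * b x) powr q / q"
      using x b0 by (intro Youngs_inequality p q1 pq) auto
    also have "(x powr (\<nu> - 1 / p) * norm (f x)) powr p = ?F x"
      using x p by (simp add: powr_mult powr_powr left_diff_distrib)
    also have "(x powr (1 / p - \<nu>) * b x) powr q = ?G x"
    proof -
      have "(1 / p - \<nu>) * q = (1 - \<nu>) * q - 1" using qp by (simp add: algebra_simps)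
      then show ?thesis using x b0[OF x] by (simp add: powr_mult powr_powr)
    qed
    also have "(x powr (\<nu> - 1 / p) * norm (f x)) * (x powr (1 / p - \<nu>) * b x)
        = x powr (\<nu> - 1 / p) * x powr (1 / p - \<nu>) * (b x * norm (f x))"
      by (simp only: mult_ac)
    also have "x powr (\<nu> - 1 / p) * x powr (1 / p - \<nu>) * (b x * norm (f x)) = b x * norm (f x)"
      using x by (simp flip: powr_add)
    finally show ?thesis .
  qed
  have sum_int: "integrable ?M (\<lambda>x. ?F x / p + ?G x / q)" using f_int b_int by simp
  show I: "integrable ?M (\<lambda>x. b x * norm (f x))"
  proof (rule Bochner_Integration.integrable_bound[OF sum_int])
    show "(\<lambda>x. b x * norm (f x)) \<in> borel_measurable ?M" using bm fm by measurable
    show "AE x in ?M. norm (b x * norm (f x)) \<le> norm (?F x / p + ?G x / q)"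
      using young b0 by (intro AE_I2) (force simp: abs_mult)
  qed
  have "(LINT x|?M. b x * norm (f x)) \<le> (LINT x|?M. ?F x / p + ?G x / q)"
    using young by (intro integral_mono I sum_int) auto
  also have "\<dots> = (LINT x|?M. ?F x) / p + (LINT x|?M. ?G x) / q"
    using f_int b_int by simp
  also have "(LINT x|?M. ?F x) = L_nu_norm \<nu> p f powr p"
  proof -
    have "0 \<le> (LINT x|?M. ?F x)" by (intro Bochner_Integration.integral_nonneg) auto
    then show ?thesis using p by (simp add: L_nu_norm_def powr_powr)
  qed
  finally show "(LINT x|?M. b x * norm (f x)) \<le> L_nu_norm \<nu> p f powr p / p + (LINT x|?M. ?G x) / q" .
qed

text \<open>
  The two hypotheses \<open>k_dom\<close> and \<open>k_lip\<close> pass from the kernel to the images: with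
  \<open>W f = \<integral> b \<bar>f\<bar>\<close>, the function \<open>T f\<close> is dominated by \<open>W f * a\<close> and has Lipschitz
  constant \<open>W f\<close>. Since \<open>b\<close> lies in the dual weighted space, \<open>W f\<close> is bounded on bounded sets,
  and hence the image of a bounded sequence meets the hypotheses of
  \<open>equilipschitz_dominated_Lq_subsequence\<close>.
\<close>

lemma compact_integral_operator:
  fixes k :: "real \<Rightarrow> real \<Rightarrow> real" and a b :: "real \<Rightarrow> real"
  assumes p: "1 < p" and q: "q = p / (p - 1)"
    and k_meas: "\<And>\<tau>. k \<tau> \<in> borel_measurable (lebesgue_on {0<..})"
    and k_dom: "\<And>\<tau> x. x > 0 \<Longrightarrow> \<bar>k \<tau> x\<bar> \<le> a \<tau> * b x"
    and k_lip: "\<And>\<tau> \<tau>' x. x > 0 \<Longrightarrow> \<bar>k \<tau> x - k \<tau>' x\<bar> \<le> \<bar>\<tau> - \<tau>'\<bar> * b x"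
    and b_meas: "b \<in> borel_measurable (lebesgue_on {0<..})"
    and b_int: "integrable (lebesgue_on {0<..}) (\<lambda>x. x powr ((1 - \<nu>) * q - 1) * b x powr q)"
    and a_nonneg: "\<And>\<tau>. 0 \<le> a \<tau>" and a_bdd: "\<And>\<tau>. a \<tau> \<le> M"
    and a_int: "integrable lebesgue (\<lambda>\<tau>. a \<tau> powr q)"
  shows "\<And>f \<tau>. f \<in> L_nu \<nu> p \<Longrightarrow> integrable (lebesgue_on {0<..}) (\<lambda>x. of_real (k \<tau> x) * f x)"
    and "compact_linear_operator (L_nu \<nu> p) (L_nu_norm \<nu> p) (L_real q) (L_real_norm q)
           (\<lambda>f \<tau>. LINT x|lebesgue_on {0<..}. of_real (k \<tau> x) * f x)"
proof -
  let ?M = "lebesgue_on {0<..} :: real measure"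
  let ?T = "\<lambda>f \<tau>. LINT x|?M. of_real (k \<tau> x) * f x :: complex"
  have q0: "q > 0" using p q by simp
  have b0: "0 \<le> b x" if "x > 0" for x
    using k_lip[OF that, of 1 0] by simp
  note pair = weighted_young_pairing[OF p q b_meas b0 b_int]
  define W where "W f = (LINT x|?M. b x * norm (f x))" for f :: "real \<Rightarrow> complex"
  have W0: "0 \<le> W f" for f unfolding W_def by (intro Bochner_Integration.integral_nonneg) (auto intro!: mult_nonneg_nonneg b0)
  have f_meas: "f \<in> borel_measurable ?M" if "f \<in> L_nu \<nu> p" for f using that by (simp add: L_nu_def)
  show I: "integrable ?M (\<lambda>x. of_real (k \<tau> x) * f x)" if f: "f \<in> L_nu \<nu> p" for f \<tau>
  proof (rule Bochner_Integration.integrable_bound)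
    show "integrable ?M (\<lambda>x. a \<tau> * (b x * norm (f x)))" using pair(1)[OF _ f] by simp
    show "(\<lambda>x. of_real (k \<tau> x) * f x) \<in> borel_measurable ?M" using k_meas[of \<tau>] f_meas[OF f] by measurable
    show "AE x in ?M. norm (of_real (k \<tau> x) * f x) \<le> norm (a \<tau> * (b x * norm (f x)))"
    proof (rule AE_I2)
      fix x assume "x \<in> space ?M"
      then have x: "x > 0" by simp
      show "norm (of_real (k \<tau> x) * f x) \<le> norm (a \<tau> * (b x * norm (f x)))"
        using mult_right_mono[OF k_dom[OF x, of \<tau>] norm_ge_zero[of "f x"]] b0[OF x] a_nonneg[of \<tau>]
        by (simp add: norm_mult abs_mult mult.assoc)
    qed
  qed
  have T_dom: "norm (?T f \<tau>) \<le> a \<tau> * W f" if f: "f \<in> L_nu \<nu> p" for f \<tau>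
  proof -
    have "norm (?T f \<tau>) \<le> (LINT x|?M. a \<tau> * (b x * norm (f x)))"
    proof (rule Bochner_Integration.integral_norm_bound_integral)
      show "norm (of_real (k \<tau> x) * f x) \<le> a \<tau> * (b x * norm (f x))" if "x \<in> space ?M" for x
        using mult_right_mono[OF k_dom[of x \<tau>] norm_ge_zero[of "f x"]] that
        by (simp add: norm_mult mult.assoc)
    qed (use I[OF f] pair(1)[OF _ f] in simp_all)
    then show ?thesis by (simp add: W_def)
  qed
  have T_lip: "norm (?T f \<tau> - ?T f \<tau>') \<le> W f * \<bar>\<tau> - \<tau>'\<bar>" if f: "f \<in> L_nu \<nu> p" for f \<tau> \<tau>'
  proof -
    have "?T f \<tau> - ?T f \<tau>' = (LINT x|?M. of_real (k \<tau> x) * f x - of_real (k \<tau>' x) * f x)"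
      using I[OF f] by simp
    also have "norm \<dots> \<le> (LINT x|?M. \<bar>\<tau> - \<tau>'\<bar> * (b x * norm (f x)))"
    proof (rule Bochner_Integration.integral_norm_bound_integral)
      show "norm (of_real (k \<tau> x) * f x - of_real (k \<tau>' x) * f x) \<le> \<bar>\<tau> - \<tau>'\<bar> * (b x * norm (f x))"
        if "x \<in> space ?M" for x
      proof -
        have "norm (of_real (k \<tau> x) * f x - of_real (k \<tau>' x) * f x) = \<bar>k \<tau> x - k \<tau>' x\<bar> * norm (f x)"
          by (simp add: norm_mult flip: left_diff_distrib of_real_diff)
        also have "\<dots> \<le> (\<bar>\<tau> - \<tau>'\<bar> * b x) * norm (f x)"
          using k_lip that by (intro mult_right_mono) auto
        finally show ?thesis by (simp add: mult.assoc)
      qed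
    qed (use I[OF f] pair(1)[OF _ f] in simp_all)
    finally show ?thesis by (simp add: W_def mult.commute)
  qed
  have T_Lq: "?T f \<in> L_real q" if f: "f \<in> L_nu \<nu> p" for f
  proof -
    have "(W f)-lipschitz_on UNIV (?T f)"
      using T_lip[OF f] W0 by (intro lipschitz_onI) (auto simp: dist_norm)
    then have "?T f \<in> borel_measurable borel"
      by (intro borel_measurable_continuous_onI lipschitz_on_continuous_on)
    then have m: "?T f \<in> borel_measurable lebesgue" by (intro measurable_completion) simp
    have "integrable lebesgue (\<lambda>\<tau>. norm (?T f \<tau>) powr q)"
    proof (rule Bochner_Integration.integrable_bound)
      show "integrable lebesgue (\<lambda>\<tau>. W f powr q * a \<tau> powr q)" using a_int by simp
      show "(\<lambda>\<tau>. norm (?T f \<tau>) powr q) \<in> borel_measurable lebesgue" using m by measurable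
      show "AE \<tau> in lebesgue. norm (norm (?T f \<tau>) powr q) \<le> norm (W f powr q * a \<tau> powr q)"
      proof (rule AE_I2)
        fix \<tau>
        have "norm (?T f \<tau>) powr q \<le> (a \<tau> * W f) powr q"
          using T_dom[OF f] q0 by (intro powr_mono2) auto
        then show "norm (norm (?T f \<tau>) powr q) \<le> norm (W f powr q * a \<tau> powr q)"
          using W0 a_nonneg by (simp add: powr_mult mult.commute)
      qed
    qed
    then show ?thesis using m by (simp add: L_real_def)
  qed
  have "\<exists>r g. strict_mono r \<and> g \<in> L_real q \<and> (\<lambda>n. L_real_norm q (\<lambda>t. ?T (s (r n)) t - g t)) \<longlonglongrightarrow> 0"
    if s: "\<And>n. s n \<in> L_nu \<nu> p" and C: "\<And>n. L_nu_norm \<nu> p (s n) \<le> C" for s :: "nat \<Rightarrow> real \<Rightarrow> complex" and C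
  proof -
    define D where "D = C powr p / p + (LINT x|?M. x powr ((1 - \<nu>) * q - 1) * b x powr q) / q"
    have WD: "W (s n) \<le> D" for n
    proof -
      have "L_nu_norm \<nu> p (s n) powr p \<le> C powr p"
        using C p by (intro powr_mono2) (auto simp: L_nu_norm_def)
      then have "L_nu_norm \<nu> p (s n) powr p / p \<le> C powr p / p" using p by (simp add: divide_right_mono)
      then show ?thesis using pair(2)[OF _ s[of n]] by (simp add: W_def D_def)
    qed
    have D0: "0 \<le> D" using WD[of 0] W0[of "s 0"] by linarith
    show ?thesis
    proof (rule equilipschitz_dominated_Lq_subsequence[OF q0, where a = "\<lambda>t. a t * D" and M = "M * D" and L = D])
      show "norm (?T (s n) t) \<le> a t * D" for n t
        using T_dom[OF s[of n], of t] mult_left_mono[OF WD[of n] a_nonneg[of t]] by linarith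
      show "a t * D \<le> M * D" for t using a_bdd D0 by (intro mult_right_mono)
      show "norm (?T (s n) t - ?T (s n) t') \<le> D * \<bar>t - t'\<bar>" for n t t'
        using T_lip[OF s[of n], of t t'] mult_right_mono[OF WD[of n], of "\<bar>t - t'\<bar>"] by linarith
      show "integrable lebesgue (\<lambda>t. (a t * D) powr q)"
        using a_int a_nonneg D0 by (simp add: powr_mult)
    qed
  qed
  moreover have "?T (\<lambda>x. f x + g x) = (\<lambda>t. ?T f t + ?T g t)" if "f \<in> L_nu \<nu> p" "g \<in> L_nu \<nu> p" for f g
    using I[OF that(1)] I[OF that(2)] by (auto simp: distrib_left)
  moreover have "?T (\<lambda>x. c * f x) = (\<lambda>t. c * ?T f t)" for c and f :: "real \<Rightarrow> complex"
    by (simp add: mult.left_commute[of _ c])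
  ultimately show "compact_linear_operator (L_nu \<nu> p) (L_nu_norm \<nu> p) (L_real q) (L_real_norm q) ?T"
    unfolding compact_linear_operator_def using T_Lq by blast
qed

section \<open>Compactness of the transform\<close>

text \<open>
  The integrand of Euler's integral for \<open>\<Gamma>(z)\<close>, rescaled by \<open>c\<close>.
\<close>

lemma integrable_powr_times_exp_minus:
  fixes z c :: real
  assumes "z > 0" "c > 0"
  shows "integrable (lebesgue_on {0<..}) (\<lambda>x. x powr (z - 1) * exp (- c * x))"
proof -
  have "(\<lambda>t. norm (complex_of_real t powr (of_real z - 1) / of_real (exp (c * t)))) absolutely_integrable_on {0<..}"
    using assms by (intro set_integrable_norm absolutely_integrable_Gamma_integral) auto
  then have "integrable (lebesgue_on {0<..}) (\<lambda>t. norm (complex_of_real t powr (of_real z - 1) / of_real (exp (c * t))))"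
    by (simp add: set_integrable_def integrable_restrict_space)
  then show ?thesis
    by (rule Bochner_Integration.integrable_cong[THEN iffD1, rotated 2])
       (auto simp: norm_divide norm_powr_real_powr exp_minus field_simps)
qed

lemma integrable_inverse_one_plus_square_powr:
  assumes "q \<ge> 1"
  shows "integrable lebesgue (\<lambda>t::real. (1 / (1 + t\<^sup>2)) powr q)"
proof (rule Bochner_Integration.integrable_bound)
  show "integrable lebesgue (\<lambda>t::real. inverse (1 + t\<^sup>2))"
    using integrable_inverse_1_plus_square
    by (simp add: set_integrable_def einterval_eq integrable_completion)
  show "(\<lambda>t::real. (1 / (1 + t\<^sup>2)) powr q) \<in> borel_measurable lebesgue"
    by (intro measurable_completion) simp
  have "(1 / (1 + t\<^sup>2)) powr q \<le> (1 / (1 + t\<^sup>2)) powr 1" for t :: real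
    using assms by (intro powr_mono') (auto simp: add_pos_nonneg)
  then show "AE t::real in lebesgue. norm ((1 / (1 + t\<^sup>2)) powr q) \<le> norm (inverse (1 + t\<^sup>2))"
    by (intro AE_I2) (auto simp: divide_inverse add_pos_nonneg)
qed

theorem theorem2:
  fixes p q \<alpha> \<nu> :: real
  assumes "1 < p" and "p \<le> 2" and "q = p / (p - 1)" and "\<alpha> \<ge> 0" and "\<alpha> + \<nu> < 1"
  shows "(\<forall>f\<in>L_nu \<nu> p. \<forall>\<tau>.
            integrable (lebesgue_on {0<..}) (\<lambda>x. of_real (F_kernel \<alpha> \<tau> x) * f x)) \<and>
         compact_linear_operator (L_nu \<nu> p) (L_nu_norm \<nu> p) (L_real q) (L_real_norm q)
           (F_transform \<alpha>)"
proof -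
  have q1: "q > 1" using assms(1) by (simp add: assms(3) less_divide_eq)
  \<comment> \<open>The midpoint between \<open>\<alpha>\<close>, above which the kernel bounds hold, and \<open>1 - \<nu>\<close>, below
    which \<open>x powr (-\<beta>)\<close> is integrable at the origin in the dual weighted norm.\<close>
  define \<beta> where "\<beta> = (1 + \<alpha> - \<nu>) / 2"
  have \<beta>: "\<alpha> < \<beta>" "\<beta> < 1 - \<nu>" using assms by (auto simp: \<beta>_def)
  obtain A where A: "A > 0" and
    dom: "\<And>x \<tau>. x > 0 \<Longrightarrow> F_kernel \<alpha> \<tau> x \<le> A * (x powr (-\<beta>) * exp (- x)) / (1 + \<tau>\<^sup>2)" and
    lip: "\<And>x \<tau> \<tau>'. x > 0 \<Longrightarrow> \<bar>F_kernel \<alpha> \<tau> x - F_kernel \<alpha> \<tau>' x\<bar> \<le> \<bar>\<tau> - \<tau>'\<bar> * (A * (x powr (-\<beta>) * exp (- x)))"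
    using F_kernel_bounds[OF assms(4) \<beta>(1)] by blast
  define b where "b x = A * (x powr (-\<beta>) * exp (- x))" for x
  have b_int: "integrable (lebesgue_on {0<..}) (\<lambda>x. x powr ((1 - \<nu>) * q - 1) * b x powr q)"
  proof -
    have "integrable (lebesgue_on {0<..}) (\<lambda>x. A powr q * (x powr ((1 - \<nu> - \<beta>) * q - 1) * exp (- q * x)))"
      using q1 \<beta> by (intro integrable_mult_right integrable_powr_times_exp_minus mult_pos_pos) auto
    then show ?thesis
    proof (rule Bochner_Integration.integrable_cong[THEN iffD1, rotated 2])
      fix x :: real assume "x \<in> space (lebesgue_on {0<..})"
      then have x: "x > 0" by simp
      have "b x powr q = A powr q * (x powr (- \<beta> * q) * exp (- q * x))"
        using A x by (simp add: b_def powr_mult powr_powr) (simp add: powr_def)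
      moreover have "x powr ((1 - \<nu> - \<beta>) * q - 1) = x powr ((1 - \<nu>) * q - 1) * x powr (- \<beta> * q)"
        by (simp add: algebra_simps flip: powr_add)
      ultimately show "A powr q * (x powr ((1 - \<nu> - \<beta>) * q - 1) * exp (- q * x)) = x powr ((1 - \<nu>) * q - 1) * b x powr q"
        by simp
    qed simp
  qed
  have b_meas: "b \<in> borel_measurable (lebesgue_on {0<..})"
    unfolding b_def[abs_def] by (intro measurable_restrict_space1 measurable_completion) simp
  have k_dom: "\<bar>F_kernel \<alpha> \<tau> x\<bar> \<le> 1 / (1 + \<tau>\<^sup>2) * b x" if "x > 0" for \<tau> x
    using dom[OF that, of \<tau>] by (simp add: b_def F_kernel_def)
  have k_lip: "\<bar>F_kernel \<alpha> \<tau> x - F_kernel \<alpha> \<tau>' x\<bar> \<le> \<bar>\<tau> - \<tau>'\<bar> * b x" if "x > 0" for \<tau> \<tau>' x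
    using lip[OF that] by (simp add: b_def)
  have a0: "0 \<le> 1 / (1 + \<tau>\<^sup>2)" and a1: "1 / (1 + \<tau>\<^sup>2) \<le> 1" for \<tau> :: real
    by (auto simp: add_pos_nonneg)
  note op = compact_integral_operator[OF assms(1,3) F_kernel_measurable k_dom k_lip b_meas b_int a0 a1
      integrable_inverse_one_plus_square_powr[OF less_imp_le[OF q1]]]
  have "F_transform \<alpha> = (\<lambda>f \<tau>. LINT x|lebesgue_on {0<..}. of_real (F_kernel \<alpha> \<tau> x) * f x)"
    by (simp add: F_transform_def[abs_def])
  then show ?thesis using op by simp
qed

end
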